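(* For the class of control policies $u_{t:N}=u^r_{t:N}+\boldsymbol\eta_t+\boldsymbol\Theta_t\psi(\tilde w_{t-1:N})$, the hard input constraint $\|u^a_{s}\|_\infty\le u_{\max}$ on the applied control (over the horizon $s=t,\dots,t+N-1$) is equivalent to $$\big|(u^r_{t:N})^{(i)}+\boldsymbol\eta_t^{(i)}\big|+\big\|\boldsymbol\Theta_t^{(i,:)}\big\|_1\,\varphi_{\max}\le u_{\max}\qquad\text{for } i=1,\dots,Nm.$$
   Context: For a vector sequence $(v_n)$, $v_{n:k}=[v_n^\top\ v_{n+1}^\top\ \cdots\ v_{n+k-1}^\top]^\top$; $V^{(i)}$ is the $i$-th entry of a vector and $M^{(i,:)}$ the $i$-th row of a matrix. The plant is $x_{t+1}=Ax_t+Bu^a_t+w_t$ with $x_t,w_t\in\mathbb R^d$, $u^a_t\in\mathbb R^m$ the applied input, $(A,B)$ controllable, and $(w_t)$ i.i.d. zero mean with components symmetrically distributed about the origin and bounded fourth moment. $(\nu_t)$, $(s_t)$ are i.i.d. Bernoulli sequences with means $p_c$, $p_s$ modelling success ($=1$) of transmission over the control channel and the sensor channel, respectively. The controller uses $\tilde x_t=s_tx_t+(1-s_t)(A\tilde x_{t-1}+Bu^a_{t-1})$, $\tilde x_{-1}=0$, $u^a_{-1}=0$, and $\tilde w_t=\tilde x_{t+1}-(A\tilde x_t+Bu^a_t)$. $N_r\le N$ are positive integers and $t$ is an optimization instant (multiple of $N_r$). $u^r_{t:N}$ is a given reference input. The parameters are $\boldsymbol\eta_t=\eta_{t:N}\in\mathbb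 R^{mN}$ and the lower block triangular matrix $\boldsymbol\Theta_t\in\mathbb R^{mN\times dN}$ with blocks $\theta_{k,t+j}\in\mathbb R^{m\times d}$ in block row $k$, block column $j$ ($0\le j\le k\le N-1$), zero for $j>k$. $\psi:\mathbb R\to\mathbb R$ is an anti-symmetric saturation function ($\psi(0)=0$, $\psi(-x)=-\psi(x)$), applied elementwise to vectors, with saturation level $\varphi_{\max}$: $\sup_x\psi(x)\le\varphi_{\max}$. The computed control $u_{t:N}$ is sent over the control channel, using a plant-side buffer, so that the applied control over the horizon is $$u^a_{t:N}=\mathcal Gu^r_{t:N}+\mathcal G\boldsymbol\eta_t+\mathcal S\boldsymbol\Theta_t\psi(\tilde w_{t-1:N}),$$ with $g_t=\nu_t$, $g_{t+\ell}=g_{t+\ell-1}+(1-g_{t+\ell-1})\nu_{t+\ell}$, $\mathcal G$ block diagonal with $m\times m$ diagonal blocks $g_{t+i-1}I_m$ for $1\le i\le N_r$ and $I_m$ for $N_r<i\le N$, and $\mathcal S$ block diagonal with diagonal blocks $\nu_tI_m,\dots,\nu_{t+\kappa-1}I_m,I_{m(N-\kappa)}$, where $\kappa$ is the reachability index: in linear coordinates where $A=\mathrm{bdiag}(A_o,A_s)$ with $A_o$ orthogonal, $A_s$ Schur stable and $B=[B_o^\top\ B_s^\top]^\top$, the matrix $[A_o^{\kappa-1}B_o\ \cdots\ A_oB_o\ B_o]$ has full row rank. The input constraint is a hard constraint: it is to hold for the policy irrespective of the realization of the noise and of the channels.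
   Formalization: The "only if" direction is proved only when φ_max equals sup ψ exactly (it fails if sup ψ < φ_max, e.g. ψ = 0); "if" holds for any φ_max ≥ sup ψ. The hard constraint ranges over all noise sequences, channel outcomes and initial states x_0. *)

theory Defs
  imports
    "HOL-Probability.Probability"
    "Jordan_Normal_Form.DL_Rank"
    "Jordan_Normal_Form.Char_Poly"
begin

no_notation Finite_Cartesian_Product.vec_nth (infixl \<open>$\<close> 90)
no_notation inner (infix \<open>\<bullet>\<close> 70)
hide_type (open) Finite_Cartesian_Product.vec

text \<open>Discrete time is \<open>int\<close>, since the estimator and the applied input start at time \<open>-1\<close>.
  Matrix and vector indices are 0-based: entry \<open>i\<close> of a stacked vector with blocks of
  length \<open>n\<close> is entry \<open>i mod n\<close> of block \<open>i div n\<close>.\<close>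

definition linf_norm :: "real vec \<Rightarrow> real" where
  "linf_norm v = Max ((\<lambda>i. \<bar>v $ i\<bar>) ` {..<dim_vec v})"

definition l1_norm :: "real vec \<Rightarrow> real" where
  "l1_norm v = (\<Sum>i<dim_vec v. \<bar>v $ i\<bar>)"

text \<open>\<open>stack n k t v\<close> is $v_{t:k}$ for a sequence of vectors of length \<open>n\<close>.\<close>

definition stack :: "nat \<Rightarrow> nat \<Rightarrow> int \<Rightarrow> (int \<Rightarrow> real vec) \<Rightarrow> real vec" where
  "stack n k t v = vec (n * k) (\<lambda>i. v (t + int (i div n)) $ (i mod n))"

text \<open>\<open>reach_mat n m k A B\<close> is $[A^{k-1}B\ \cdots\ AB\ B]$ for $A$ of size $n \times n$ and
  $B$ of size $n \times m$.\<close>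

definition reach_mat :: "nat \<Rightarrow> nat \<Rightarrow> nat \<Rightarrow> real mat \<Rightarrow> real mat \<Rightarrow> real mat" where
  "reach_mat n m k A B =
     mat n (m * k) (\<lambda>(i, j). ((A ^\<^sub>m (k - 1 - j div m)) * B) $$ (i, j mod m))"

definition controllable :: "nat \<Rightarrow> nat \<Rightarrow> real mat \<Rightarrow> real mat \<Rightarrow> bool" where
  "controllable n m A B \<longleftrightarrow> vec_space.rank n (reach_mat n m n A B) = n"

definition orthogonal_matrix :: "nat \<Rightarrow> real mat \<Rightarrow> bool" where
  "orthogonal_matrix n Q \<longleftrightarrow>
     Q \<in> carrier_mat n n \<and> transpose_mat Q * Q = 1\<^sub>m n \<and> Q * transpose_mat Q = 1\<^sub>m n"

definition schur_stable :: "nat \<Rightarrow> real mat \<Rightarrow> bool" where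
  "schur_stable n S \<longleftrightarrow> S \<in> carrier_mat n n \<and>
     (\<forall>z. eigenvalue (map_mat complex_of_real S) z \<longrightarrow> cmod z < 1)"

text \<open>The coordinate change is $z = P x$ with inverse \<open>Q\<close>. Either block may have size 0.\<close>

definition reachability_index :: "nat \<Rightarrow> nat \<Rightarrow> real mat \<Rightarrow> real mat \<Rightarrow> nat \<Rightarrow> bool" where
  "reachability_index d m A B \<kappa> \<longleftrightarrow>
     (\<exists>no ns Ao As Bo Bs P Q.
        no + ns = d \<and>
        orthogonal_matrix no Ao \<and> schur_stable ns As \<and>
        Bo \<in> carrier_mat no m \<and> Bs \<in> carrier_mat ns m \<and>
        similar_mat_wit (four_block_mat Ao (0\<^sub>m no ns) (0\<^sub>m ns no) As) A P Q \<and>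
        P * B = Bo @\<^sub>r Bs \<and>
        vec_space.rank no (reach_mat no m \<kappa> Ao Bo) = no)"

text \<open>A realization of all exogenous quantities: initial state, noise sequence, and success
  indicators of the control and of the sensor channel. Only times \<open>\<ge> 0\<close> are used.\<close>

datatype realization = Realization
  (init: "real vec")
  (noise: "int \<Rightarrow> real vec")
  (ctrl: "int \<Rightarrow> bool")
  (sens: "int \<Rightarrow> bool")

definition realizations :: "nat \<Rightarrow> realization set" where
  "realizations d =
     {\<omega>. init \<omega> \<in> carrier_vec d \<and> (\<forall>k\<ge>0. noise \<omega> k \<in> carrier_vec d)}"

text \<open>Borel sets of vectors of length \<open>d\<close>.\<close>

definition vec_borel :: "nat \<Rightarrow> real vec measure" where
  "vec_borel d = vimage_algebra (carrier_vec d) (\<lambda>v. \<lambda>i\<in>{..<d}. v $ i)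
     (Pi\<^sub>M {..<d} (\<lambda>_. borel))"

text \<open>The stochastic model is a probability measure on the path space \<open>realizations d\<close>, under
  which the coordinate processes have the stated laws. The fourth moment is that of the
  Euclidean norm, since $(w \bullet w)^2 = |w|^4$.\<close>

definition noise_model :: "nat \<Rightarrow> realization measure \<Rightarrow> bool" where
  "noise_model d M \<longleftrightarrow>
     prob_space.indep_vars M (\<lambda>_. vec_borel d) (\<lambda>k \<omega>. noise \<omega> k) {0..} \<and>
     (\<forall>k\<ge>0. distr M (vec_borel d) (\<lambda>\<omega>. noise \<omega> k) = distr M (vec_borel d) (\<lambda>\<omega>. noise \<omega> 0)) \<and>
     (\<forall>k\<ge>0. \<forall>i<d. integrable M (\<lambda>\<omega>. noise \<omega> k $ i) \<and> (\<integral>\<omega>. noise \<omega> k $ i \<partial>M) = 0) \<and>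
     (\<forall>k\<ge>0. \<forall>i<d.
        distr M borel (\<lambda>\<omega>. noise \<omega> k $ i) = distr M borel (\<lambda>\<omega>. - (noise \<omega> k $ i))) \<and>
     (\<exists>C. \<forall>k\<ge>0. integrable M (\<lambda>\<omega>. (noise \<omega> k \<bullet> noise \<omega> k) ^ 2) \<and>
        (\<integral>\<omega>. (noise \<omega> k \<bullet> noise \<omega> k) ^ 2 \<partial>M) \<le> C)"

definition iid_bernoulli :: "realization measure \<Rightarrow> real \<Rightarrow> (realization \<Rightarrow> int \<Rightarrow> bool) \<Rightarrow> bool" where
  "iid_bernoulli M p b \<longleftrightarrow> 0 \<le> p \<and> p \<le> 1 \<and>
     prob_space.indep_vars M (\<lambda>_. count_space UNIV) (\<lambda>k \<omega>. b \<omega> k) {0..} \<and>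
     (\<forall>k\<ge>0. distr M (count_space UNIV) (\<lambda>\<omega>. b \<omega> k) = measure_pmf (bernoulli_pmf p))"

definition stochastic_model :: "nat \<Rightarrow> real \<Rightarrow> real \<Rightarrow> realization measure \<Rightarrow> bool" where
  "stochastic_model d pc ps M \<longleftrightarrow>
     prob_space M \<and> space M = realizations d \<and>
     noise_model d M \<and> iid_bernoulli M pc ctrl \<and> iid_bernoulli M ps sens"

text \<open>\<open>gate \<nu> t l\<close> is $g_{t+l}$.\<close>

primrec gate :: "(int \<Rightarrow> bool) \<Rightarrow> int \<Rightarrow> nat \<Rightarrow> real" where
  "gate \<nu> t 0 = of_bool (\<nu> t)"
| "gate \<nu> t (Suc l) = gate \<nu> t l + (1 - gate \<nu> t l) * of_bool (\<nu> (t + int (Suc l)))"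

definition block_diag :: "nat \<Rightarrow> nat \<Rightarrow> (nat \<Rightarrow> real) \<Rightarrow> real mat" where
  "block_diag m N c = mat (m * N) (m * N) (\<lambda>(i, j). if i = j then c (i div m) else 0)"

definition G_mat :: "nat \<Rightarrow> nat \<Rightarrow> nat \<Rightarrow> (int \<Rightarrow> bool) \<Rightarrow> int \<Rightarrow> real mat" where
  "G_mat m N Nr \<nu> t = block_diag m N (\<lambda>k. if k < Nr then gate \<nu> t k else 1)"

definition S_mat :: "nat \<Rightarrow> nat \<Rightarrow> nat \<Rightarrow> (int \<Rightarrow> bool) \<Rightarrow> int \<Rightarrow> real mat" where
  "S_mat m N \<kappa> \<nu> t = block_diag m N (\<lambda>k. if k < \<kappa> then of_bool (\<nu> (t + int k)) else 1)"

definition lower_block_triangular :: "nat \<Rightarrow> nat \<Rightarrow> nat \<Rightarrow> real mat \<Rightarrow> bool" where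
  "lower_block_triangular m d N \<Theta> \<longleftrightarrow> \<Theta> \<in> carrier_mat (m * N) (d * N) \<and>
     (\<forall>i<m * N. \<forall>j<d * N. j div d > i div m \<longrightarrow> \<Theta> $$ (i, j) = 0)"

text \<open>Here \<open>\<phi>max\<close> is an upper bound of \<open>\<psi>\<close>, not necessarily the least one.\<close>

definition saturation :: "(real \<Rightarrow> real) \<Rightarrow> real \<Rightarrow> bool" where
  "saturation \<psi> \<phi>max \<longleftrightarrow> \<psi> 0 = 0 \<and> (\<forall>x. \<psi> (- x) = - \<psi> x) \<and> (\<forall>x. \<psi> x \<le> \<phi>max)"

text \<open>Trajectories \<open>x\<close>, \<open>xt\<close>, \<open>wt\<close>, \<open>ua\<close> of state, estimate, innovation and applied input under
  the realization \<open>\<omega>\<close>. Since \<open>\<Theta>\<close> is lower block triangular, the input at time \<open>t + i\<close> depends on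
  innovations up to time \<open>t + i - 1\<close> only, so the equations can be solved recursively.
  The inputs applied before the horizon, \<open>up \<omega>\<close>, may depend on the realization in any way.\<close>

definition closed_loop ::
  "nat \<Rightarrow> nat \<Rightarrow> nat \<Rightarrow> nat \<Rightarrow> nat \<Rightarrow> real mat \<Rightarrow> real mat \<Rightarrow> (real \<Rightarrow> real) \<Rightarrow> int \<Rightarrow>
   (realization \<Rightarrow> int \<Rightarrow> real vec) \<Rightarrow> (int \<Rightarrow> real vec) \<Rightarrow> real vec \<Rightarrow> real mat \<Rightarrow> realization \<Rightarrow>
   (int \<Rightarrow> real vec) \<Rightarrow> (int \<Rightarrow> real vec) \<Rightarrow> (int \<Rightarrow> real vec) \<Rightarrow> (int \<Rightarrow> real vec) \<Rightarrow> bool" where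
  "closed_loop d m N Nr \<kappa> A B \<psi> t up ur \<eta> \<Theta> \<omega> x xt wt ua \<longleftrightarrow>
     (\<forall>k\<ge>-1. ua k \<in> carrier_vec m) \<and> ua (-1) = 0\<^sub>v m \<and>
     x 0 = init \<omega> \<and>
     (\<forall>k\<ge>0. x (k + 1) = A *\<^sub>v x k + B *\<^sub>v ua k + noise \<omega> k) \<and>
     xt (-1) = 0\<^sub>v d \<and>
     (\<forall>k\<ge>0. xt k = of_bool (sens \<omega> k) \<cdot>\<^sub>v x k
        + (1 - of_bool (sens \<omega> k)) \<cdot>\<^sub>v (A *\<^sub>v xt (k - 1) + B *\<^sub>v ua (k - 1))) \<and>
     (\<forall>k\<ge>-1. wt k = xt (k + 1) - (A *\<^sub>v xt k + B *\<^sub>v ua k)) \<and>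
     (\<forall>k. 0 \<le> k \<and> k < t \<longrightarrow> ua k = up \<omega> k) \<and>
     stack m N t ua =
       G_mat m N Nr (ctrl \<omega>) t *\<^sub>v stack m N t ur + G_mat m N Nr (ctrl \<omega>) t *\<^sub>v \<eta>
       + S_mat m N \<kappa> (ctrl \<omega>) t *\<^sub>v (\<Theta> *\<^sub>v map_vec \<psi> (stack d N (t - 1) wt))"

definition hard_input_constraint ::
  "nat \<Rightarrow> nat \<Rightarrow> nat \<Rightarrow> nat \<Rightarrow> nat \<Rightarrow> real mat \<Rightarrow> real mat \<Rightarrow> (real \<Rightarrow> real) \<Rightarrow> int \<Rightarrow>
   (realization \<Rightarrow> int \<Rightarrow> real vec) \<Rightarrow> (int \<Rightarrow> real vec) \<Rightarrow> real vec \<Rightarrow> real mat \<Rightarrow>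
   realization measure \<Rightarrow> real \<Rightarrow> bool" where
  "hard_input_constraint d m N Nr \<kappa> A B \<psi> t up ur \<eta> \<Theta> M umax \<longleftrightarrow>
     (\<forall>\<omega>\<in>space M. \<forall>x xt wt ua.
        closed_loop d m N Nr \<kappa> A B \<psi> t up ur \<eta> \<Theta> \<omega> x xt wt ua \<longrightarrow>
        (\<forall>s. t \<le> s \<and> s < t + int N \<longrightarrow> linf_norm (ua s) \<le> umax))"

end

theory Submission
  imports Defs
begin

text \<open>
  Entry \<open>i\<close> of the applied input over the horizon has the form \<open>g * a + c * b\<close>, where
  \<open>a\<close> is entry \<open>i\<close> of the open-loop part (reference plus \<open>\<eta>\<close>), \<open>b\<close> is the inner product
  of row \<open>i\<close> of \<open>\<Theta>\<close> with the saturated innovations, and \<open>g\<close>, \<open>c\<close> are weights in \<open>[0, 1]\<close>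
  set by the control channel. Since \<open>\<psi>\<close> is odd and bounded above by \<open>\<phi>max\<close>, it is bounded by
  \<open>\<phi>max\<close> in modulus, so \<open>\<bar>b\<bar>\<close> is at most the 1-norm of the row times \<open>\<phi>max\<close>. Hence the
  row-wise bound implies the hard constraint.

  Conversely, consider realizations in which every transmission succeeds. Then \<open>g = c = 1\<close>, the
  estimate equals the state, and the innovations are exactly the noise vectors, preceded at time
  \<open>-1\<close> by the initial state. They can therefore be prescribed arbitrarily
  (\<open>exists_closed_loop_with_innovations\<close>). Choosing every innovation
  entry as \<open>z\<close> with the sign of the corresponding entry of the row, flipped if \<open>a < 0\<close>,
  aligns all terms and produces an input of modulus at least
  \<open>\<bar>a\<bar>\<close> plus the 1-norm times \<open>\<psi> z\<close>. The hard constraint bounds this by \<open>umax\<close> for every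
  \<open>z\<close>, and taking the supremum over \<open>z\<close> yields the row-wise bound. The supremum is taken
  only after the bound by \<open>umax\<close> is known for each single \<open>z\<close>, since \<open>\<psi>\<close> need not attain it.
  Every such sample path counts, however unlikely it is: the hard constraint quantifies over the
  whole path space.
\<close>

section \<open>Norms and signs\<close>

lemma linf_norm_le_iff:
  assumes "v \<in> carrier_vec m" "0 < m"
  shows "linf_norm v \<le> u \<longleftrightarrow> (\<forall>j<m. \<bar>v $ j\<bar> \<le> u)"
proof -
  have ne: "(\<lambda>i. \<bar>v $ i\<bar>) ` {..<m} \<noteq> {}"
    using \<open>0 < m\<close> by auto
  show ?thesis
    using assms(1) by (auto simp: linf_norm_def Max_le_iff[OF _ ne])
qed

lemma abs_saturation_le:
  assumes "saturation \<psi> \<phi>max"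
  shows "\<bar>\<psi> x\<bar> \<le> \<phi>max"
proof -
  have "\<psi> x \<le> \<phi>max" "\<psi> (- x) \<le> \<phi>max" "\<psi> (- x) = - \<psi> x"
    using assms unfolding saturation_def by blast+
  then show ?thesis by linarith
qed

lemma abs_scalar_prod_le_l1_norm:
  assumes "r \<in> carrier_vec n" "v \<in> carrier_vec n" "\<And>j. j < n \<Longrightarrow> \<bar>v $ j\<bar> \<le> c"
  shows "\<bar>r \<bullet> v\<bar> \<le> l1_norm r * c"
proof -
  have "\<bar>r \<bullet> v\<bar> \<le> (\<Sum>j<n. \<bar>r $ j * v $ j\<bar>)"
    using assms(1,2) by (simp add: scalar_prod_def atLeast0LessThan)
  also have "\<dots> \<le> (\<Sum>j<n. \<bar>r $ j\<bar> * c)"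
    by (intro sum_mono) (simp add: abs_mult mult_left_mono assms(3))
  also have "\<dots> = l1_norm r * c"
    using assms(1) by (simp add: l1_norm_def sum_distrib_right)
  finally show ?thesis .
qed

text \<open>This is what lets the sign pattern of a row of \<open>\<Theta>\<close> be imposed on the innovations, inside
  the saturation. At \<open>c = 0\<close> it rests on \<open>\<psi> 0 = 0\<close>, elsewhere on oddness.\<close>

lemma saturation_sgn_mult:
  assumes "saturation \<psi> \<phi>max"
  shows "\<psi> (sgn c * z) = sgn c * \<psi> z"
  using assms by (auto simp: saturation_def sgn_if)

section \<open>Entries of the applied input\<close>

lemma stack_carrier [simp]: "stack n k t v \<in> carrier_vec (n * k)"
  by (simp add: stack_def)

lemma block_diag_carrier [simp]: "block_diag m N c \<in> carrier_mat (m * N) (m * N)"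
  by (simp add: block_diag_def)

lemma block_diag_mult_vec_index:
  assumes "v \<in> carrier_vec (m * N)" "i < m * N"
  shows "(block_diag m N c *\<^sub>v v) $ i = c (i div m) * v $ i"
proof -
  have "(block_diag m N c *\<^sub>v v) $ i
      = (\<Sum>j\<in>{0..<m * N}. (if i = j then c (i div m) else 0) * v $ j)"
    using assms by (auto simp: block_diag_def scalar_prod_def intro!: sum.cong)
  also have "\<dots> = (\<Sum>j\<in>{0..<m * N}. if i = j then c (i div m) * v $ j else 0)"
    by (intro sum.cong) auto
  also have "\<dots> = c (i div m) * v $ i"
    using assms by simp
  finally show ?thesis .
qed

lemma gate_in_unit_interval: "0 \<le> gate \<nu> t l \<and> gate \<nu> t l \<le> 1"
  by (induction l) (auto simp: of_bool_def)

lemma gate_all_success: "gate (\<lambda>_. True) t l = 1"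
  by (induction l) auto

lemma closed_loop_input_entry:
  assumes loop: "closed_loop d m N Nr \<kappa> A B \<psi> t up ur \<eta> \<Theta> \<omega> x xt wt ua"
    and \<eta>: "\<eta> \<in> carrier_vec (m * N)" and \<Theta>: "\<Theta> \<in> carrier_mat (m * N) (d * N)"
    and i: "i < m * N"
  shows "ua (t + int (i div m)) $ (i mod m) =
      (if i div m < Nr then gate (ctrl \<omega>) t (i div m) else 1) * (stack m N t ur $ i + \<eta> $ i)
      + (if i div m < \<kappa> then of_bool (ctrl \<omega> (t + int (i div m))) else 1)
        * (row \<Theta> i \<bullet> map_vec \<psi> (stack d N (t - 1) wt))"
proof -
  let ?w = "map_vec \<psi> (stack d N (t - 1) wt)"
  have \<Theta>w: "\<Theta> *\<^sub>v ?w \<in> carrier_vec (m * N)" "(\<Theta> *\<^sub>v ?w) $ i = row \<Theta> i \<bullet> ?w"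
    using \<Theta> i by (auto simp: stack_def)
  have "stack m N t ua =
      G_mat m N Nr (ctrl \<omega>) t *\<^sub>v stack m N t ur + G_mat m N Nr (ctrl \<omega>) t *\<^sub>v \<eta>
      + S_mat m N \<kappa> (ctrl \<omega>) t *\<^sub>v (\<Theta> *\<^sub>v ?w)"
    using loop by (simp add: closed_loop_def)
  then have "stack m N t ua $ i =
      (G_mat m N Nr (ctrl \<omega>) t *\<^sub>v stack m N t ur) $ i + (G_mat m N Nr (ctrl \<omega>) t *\<^sub>v \<eta>) $ i
      + (S_mat m N \<kappa> (ctrl \<omega>) t *\<^sub>v (\<Theta> *\<^sub>v ?w)) $ i"
    using i by (simp add: G_mat_def S_mat_def block_diag_def)
  also have "\<dots> =
      (if i div m < Nr then gate (ctrl \<omega>) t (i div m) else 1) * (stack m N t ur $ i + \<eta> $ i)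
      + (if i div m < \<kappa> then of_bool (ctrl \<omega> (t + int (i div m))) else 1) * (row \<Theta> i \<bullet> ?w)"
    unfolding G_mat_def S_mat_def
    by (simp only: block_diag_mult_vec_index[OF stack_carrier i] block_diag_mult_vec_index[OF \<eta> i]
        block_diag_mult_vec_index[OF \<Theta>w(1) i] \<Theta>w(2) distrib_left)
  finally show ?thesis
    using i by (simp add: stack_def)
qed

lemma closed_loop_inputs_bounded_iff:
  assumes loop: "closed_loop d m N Nr \<kappa> A B \<psi> t up ur \<eta> \<Theta> \<omega> x xt wt ua"
    and "0 < m" "0 \<le> t"
  shows "(\<forall>s. t \<le> s \<and> s < t + int N \<longrightarrow> linf_norm (ua s) \<le> umax)
    \<longleftrightarrow> (\<forall>i<m * N. \<bar>ua (t + int (i div m)) $ (i mod m)\<bar> \<le> umax)" (is "?L \<longleftrightarrow> ?R")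
proof -
  have ua: "ua s \<in> carrier_vec m" if "t \<le> s" for s
    using loop that \<open>0 \<le> t\<close> by (simp add: closed_loop_def)
  show ?thesis
  proof
    assume L: ?L
    show ?R
    proof (intro allI impI)
      fix i assume "i < m * N"
      then have "i div m < N" "i mod m < m"
        using \<open>0 < m\<close> by (simp_all add: less_mult_imp_div_less mult.commute)
      moreover from this have "linf_norm (ua (t + int (i div m))) \<le> umax"
        using L by simp
      ultimately show "\<bar>ua (t + int (i div m)) $ (i mod m)\<bar> \<le> umax"
        using linf_norm_le_iff[OF ua \<open>0 < m\<close>] by simp
    qed
  next
    assume R: ?R
    show ?L
    proof (intro allI impI)
      fix s assume s: "t \<le> s \<and> s < t + int N"
      have "\<bar>ua s $ j\<bar> \<le> umax" if "j < m" for j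
      proof -
        define k where "k = nat (s - t)"
        have k: "k < N" "s = t + int k"
          using s by (auto simp: k_def)
        have "m * k + j < m * Suc k"
          using that by simp
        also have "\<dots> \<le> m * N"
          using k(1) by (intro mult_le_mono2) simp
        finally have "m * k + j < m * N" .
        moreover have "(m * k + j) div m = k" "(m * k + j) mod m = j"
          using that by auto
        ultimately show ?thesis
          using R k(2) by metis
      qed
      then show "linf_norm (ua s) \<le> umax"
        using linf_norm_le_iff[OF ua \<open>0 < m\<close>] s by blast
    qed
  qed
qed

section \<open>Sample paths with prescribed innovations\<close>

text \<open>Perfect communication makes the innovations coincide with the exogenous vectors, which are
  free. The saturated feedback then depends on known data only, so the input over the horizon can be
  written down first and the state computed from it.\<close>

lemma exists_closed_loop_with_innovations:
  fixes w :: "int \<Rightarrow> real vec"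
  assumes dims: "0 < m" "0 \<le> t" and A: "A \<in> carrier_mat d d" and B: "B \<in> carrier_mat d m"
    and w: "\<And>k. w k \<in> carrier_vec d"
    and \<omega>: "\<omega> = Realization (w (- 1)) w (\<lambda>_. True) (\<lambda>_. True)"
    and past: "\<And>k. 0 \<le> k \<Longrightarrow> k < t \<Longrightarrow> up \<omega> k \<in> carrier_vec m"
    and \<eta>: "\<eta> \<in> carrier_vec (m * N)" and \<Theta>: "\<Theta> \<in> carrier_mat (m * N) (d * N)"
  shows "\<exists>x xt ua. closed_loop d m N Nr \<kappa> A B \<psi> t up ur \<eta> \<Theta> \<omega> x xt w ua"
proof -
  define U where "U = G_mat m N Nr (ctrl \<omega>) t *\<^sub>v stack m N t ur + G_mat m N Nr (ctrl \<omega>) t *\<^sub>v \<eta>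
       + S_mat m N \<kappa> (ctrl \<omega>) t *\<^sub>v (\<Theta> *\<^sub>v map_vec \<psi> (stack d N (t - 1) w))"
  define ua where "ua k = (if k < 0 then 0\<^sub>v m else if k < t then up \<omega> k
       else vec m (\<lambda>j. U $ (m * nat (k - t) + j)))" for k
  define X where "X = rec_nat (w (- 1)) (\<lambda>n v. A *\<^sub>v v + B *\<^sub>v ua (int n) + w (int n))"
  define x where "x k = X (nat k)" for k
  define xt where "xt k = (if k < 0 then 0\<^sub>v d else x k)" for k
  have ua: "ua k \<in> carrier_vec m" for k
    using past by (simp add: ua_def)
  have X_Suc: "X (Suc n) = A *\<^sub>v X n + B *\<^sub>v ua (int n) + w (int n)" for n
    by (simp add: X_def)
  have "X n \<in> carrier_vec d" for n
  proof (induction n)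
    case 0
    then show ?case using w by (simp add: X_def)
  next
    case (Suc n)
    then show ?case
      unfolding X_Suc using A B ua w by (intro add_carrier_vec mult_mat_vec_carrier)
  qed
  then have x: "x k \<in> carrier_vec d" for k
    by (simp add: x_def)
  have x_step: "x (k + 1) = A *\<^sub>v x k + B *\<^sub>v ua k + w k" if "0 \<le> k" for k
    using X_Suc[of "nat k"] that by (simp add: x_def nat_add_distrib)
  have xt: "xt k \<in> carrier_vec d" for k
    using x by (simp add: xt_def)
  have pred: "A *\<^sub>v xt k + B *\<^sub>v ua k \<in> carrier_vec d" for k
    using A B xt ua by (intro add_carrier_vec mult_mat_vec_carrier)
  have estimate: "xt k = of_bool (sens \<omega> k) \<cdot>\<^sub>v x k
      + (1 - of_bool (sens \<omega> k)) \<cdot>\<^sub>v (A *\<^sub>v xt (k - 1) + B *\<^sub>v ua (k - 1))" if "0 \<le> k" for k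
  proof -
    have "(0 :: real) \<cdot>\<^sub>v (A *\<^sub>v xt (k - 1) + B *\<^sub>v ua (k - 1)) = 0\<^sub>v d"
      using carrier_vecD[OF pred[of "k - 1"]] B by (intro eq_vecI) auto
    then show ?thesis
      using that x[of k] by (simp add: xt_def \<omega>)
  qed
  have innovation: "w k = xt (k + 1) - (A *\<^sub>v xt k + B *\<^sub>v ua k)" if "- 1 \<le> k" for k
  proof (cases "k = - 1")
    case True
    have "A *\<^sub>v 0\<^sub>v d = 0\<^sub>v d" "B *\<^sub>v 0\<^sub>v m = 0\<^sub>v d"
      using A B by (auto intro!: eq_vecI)
    moreover have "xt 0 = w (- 1)"
      by (simp add: xt_def x_def X_def)
    ultimately show ?thesis
      using True w by (simp add: xt_def ua_def)
  next
    case False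
    with that have "0 \<le> k" by simp
    then have "xt (k + 1) = (A *\<^sub>v xt k + B *\<^sub>v ua k) + w k"
      using x_step[of k] by (simp add: xt_def)
    moreover have "v = (p + v) - p"
      if "p \<in> carrier_vec d" "v \<in> carrier_vec d" for p v :: "real vec"
      using that by (intro eq_vecI) auto
    ultimately show ?thesis
      using pred[of k] w[of k] by metis
  qed
  have horizon: "stack m N t ua = U"
  proof (rule eq_vecI)
    have dimU: "dim_vec U = m * N"
      by (simp add: U_def S_mat_def block_diag_def)
    then show "dim_vec (stack m N t ua) = dim_vec U"
      by (simp add: stack_def)
    fix i assume "i < dim_vec U"
    then show "stack m N t ua $ i = U $ i"
      using dims dimU by (simp add: stack_def ua_def)
  qed
  have "closed_loop d m N Nr \<kappa> A B \<psi> t up ur \<eta> \<Theta> \<omega> x xt w ua"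
    unfolding closed_loop_def U_def[symmetric]
  proof (intro conjI allI impI)
    show "ua k \<in> carrier_vec m" for k by (rule ua)
    show "ua (- 1) = 0\<^sub>v m" by (simp add: ua_def)
    show "x 0 = init \<omega>" by (simp add: x_def X_def \<omega>)
    show "x (k + 1) = A *\<^sub>v x k + B *\<^sub>v ua k + noise \<omega> k" if "0 \<le> k" for k
      using x_step[OF that] by (simp add: \<omega>)
    show "xt (- 1) = 0\<^sub>v d" by (simp add: xt_def)
    show "ua k = up \<omega> k" if "0 \<le> k \<and> k < t" for k
      using that by (simp add: ua_def)
  qed (use estimate innovation horizon in auto)
  then show ?thesis by blast
qed

section \<open>The hard constraint and the row-wise bound\<close>

text \<open>Channel weights can only shrink the two contributions, so the worst case is a sum of moduli.\<close>

lemma row_bound_imp_hard_input_constraint: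
  assumes dims: "0 < m" "0 \<le> t"
    and \<eta>: "\<eta> \<in> carrier_vec (m * N)" and \<Theta>: "\<Theta> \<in> carrier_mat (m * N) (d * N)"
    and sat: "saturation \<psi> \<phi>max"
    and bound: "\<And>i. i < m * N \<Longrightarrow>
      \<bar>stack m N t ur $ i + \<eta> $ i\<bar> + l1_norm (row \<Theta> i) * \<phi>max \<le> umax"
  shows "hard_input_constraint d m N Nr \<kappa> A B \<psi> t up ur \<eta> \<Theta> M umax"
  unfolding hard_input_constraint_def
proof (intro ballI allI impI)
  fix \<omega> x xt wt ua s
  assume loop: "closed_loop d m N Nr \<kappa> A B \<psi> t up ur \<eta> \<Theta> \<omega> x xt wt ua"
    and s: "t \<le> s \<and> s < t + int N"
  have "\<bar>ua (t + int (i div m)) $ (i mod m)\<bar> \<le> umax" if i: "i < m * N" for i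
  proof -
    define a where "a = stack m N t ur $ i + \<eta> $ i"
    define b where "b = row \<Theta> i \<bullet> map_vec \<psi> (stack d N (t - 1) wt)"
    define g where "g = (if i div m < Nr then gate (ctrl \<omega>) t (i div m) else 1)"
    define c :: real
      where "c = (if i div m < \<kappa> then of_bool (ctrl \<omega> (t + int (i div m))) else 1)"
    have eq: "ua (t + int (i div m)) $ (i mod m) = g * a + c * b"
      unfolding a_def b_def g_def c_def by (rule closed_loop_input_entry[OF loop \<eta> \<Theta> i])
    have weights: "\<bar>g\<bar> \<le> 1" "\<bar>c\<bar> \<le> 1"
      using gate_in_unit_interval[of "ctrl \<omega>" t "i div m"] by (auto simp: g_def c_def)
    have b: "\<bar>b\<bar> \<le> l1_norm (row \<Theta> i) * \<phi>max"
      unfolding b_def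
    proof (rule abs_scalar_prod_le_l1_norm)
      show "row \<Theta> i \<in> carrier_vec (d * N)"
        using \<Theta> i by auto
      show "\<bar>map_vec \<psi> (stack d N (t - 1) wt) $ j\<bar> \<le> \<phi>max" if "j < d * N" for j
        using that abs_saturation_le[OF sat] by (simp add: stack_def)
    qed simp
    have "\<bar>g * a + c * b\<bar> \<le> \<bar>g\<bar> * \<bar>a\<bar> + \<bar>c\<bar> * \<bar>b\<bar>"
      by (metis abs_mult abs_triangle_ineq)
    also have "\<dots> \<le> \<bar>a\<bar> + \<bar>b\<bar>"
      using weights by (intro add_mono mult_left_le_one_le) auto
    also have "\<dots> \<le> umax"
      using b bound[OF i] by (simp add: a_def)
    finally show ?thesis
      by (simp add: eq)
  qed
  then show "linf_norm (ua s) \<le> umax"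
    using closed_loop_inputs_bounded_iff[OF loop dims] s by blast
qed

text \<open>The worst case: perfect communication, and every innovation entry equal to \<open>z\<close> up to the sign
  that makes all feedback terms reinforce the open-loop part.\<close>

lemma hard_input_constraint_imp_row_bound:
  assumes dims: "0 < m" "0 \<le> t" and A: "A \<in> carrier_mat d d" and B: "B \<in> carrier_mat d m"
    and space: "space M = realizations d"
    and past: "\<And>\<omega> k. \<omega> \<in> space M \<Longrightarrow> 0 \<le> k \<Longrightarrow> k < t \<Longrightarrow> up \<omega> k \<in> carrier_vec m"
    and \<eta>: "\<eta> \<in> carrier_vec (m * N)" and \<Theta>: "\<Theta> \<in> carrier_mat (m * N) (d * N)"
    and sat: "saturation \<psi> \<phi>max" and tight: "(SUP z. \<psi> z) = \<phi>max"
    and hard: "hard_input_constraint d m N Nr \<kappa> A B \<psi> t up ur \<eta> \<Theta> M umax"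
    and i: "i < m * N"
  shows "\<bar>stack m N t ur $ i + \<eta> $ i\<bar> + l1_norm (row \<Theta> i) * \<phi>max \<le> umax"
proof -
  define a where "a = stack m N t ur $ i + \<eta> $ i"
  define l where "l = l1_norm (row \<Theta> i)"
  \<comment> \<open>Not \<open>sgn a\<close>: for \<open>a = 0\<close> the feedback term alone must still be exercised.\<close>
  define \<sigma> :: real where "\<sigma> = (if a < 0 then - 1 else 1)"
  have \<sigma>: "\<sigma> * a = \<bar>a\<bar>" "\<sigma> * \<sigma> = 1" "\<bar>\<sigma>\<bar> = 1" "sgn \<sigma> = \<sigma>"
    by (auto simp: \<sigma>_def)
  have l: "l = (\<Sum>j<d * N. \<bar>\<Theta> $$ (i, j)\<bar>)"
    using \<Theta> i by (simp add: l_def l1_norm_def)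
  have *: "\<bar>a\<bar> + l * \<psi> z \<le> umax" for z
  proof -
    \<comment> \<open>Innovation block \<open>0\<close>, which multiplies block column \<open>0\<close> of \<open>\<Theta>\<close>, is at time \<open>t - 1\<close>.\<close>
    define w where
      "w k = vec d (\<lambda>j. sgn (\<sigma> * \<Theta> $$ (i, d * nat (k - (t - 1)) + j)) * z)" for k
    define \<omega> where "\<omega> = Realization (w (- 1)) w (\<lambda>_. True) (\<lambda>_. True)"
    have w: "w k \<in> carrier_vec d" for k
      by (simp add: w_def)
    have \<omega>_space: "\<omega> \<in> space M"
      using w by (simp add: space realizations_def \<omega>_def)
    obtain x xt ua where loop: "closed_loop d m N Nr \<kappa> A B \<psi> t up ur \<eta> \<Theta> \<omega> x xt w ua"
      using exists_closed_loop_with_innovations[where w = w and up = up,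
          OF dims A B w \<omega>_def past[OF \<omega>_space] \<eta> \<Theta>]
      by blast
    have "stack d N (t - 1) w $ j = sgn (\<sigma> * \<Theta> $$ (i, j)) * z" if "j < d * N" for j
    proof -
      have "0 < d" using that by (cases d) auto
      then show ?thesis
        using that by (simp add: stack_def w_def)
    qed
    then have \<psi>w: "map_vec \<psi> (stack d N (t - 1) w) $ j = sgn (\<sigma> * \<Theta> $$ (i, j)) * \<psi> z"
      if "j < d * N" for j
      using that saturation_sgn_mult[OF sat] by (simp add: carrier_vecD[OF stack_carrier])
    have "row \<Theta> i \<bullet> map_vec \<psi> (stack d N (t - 1) w)
        = (\<Sum>j<d * N. \<Theta> $$ (i, j) * (sgn (\<sigma> * \<Theta> $$ (i, j)) * \<psi> z))"
      using \<Theta> i \<psi>w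
      by (auto simp: scalar_prod_def atLeast0LessThan carrier_vecD[OF stack_carrier]
          simp del: index_map_vec intro!: sum.cong)
    also have "\<dots> = (\<Sum>j<d * N. \<bar>\<Theta> $$ (i, j)\<bar> * (\<sigma> * \<psi> z))"
      by (intro sum.cong refl) (simp add: sgn_mult \<sigma> abs_sgn mult.assoc mult.left_commute)
    also have "\<dots> = \<sigma> * (l * \<psi> z)"
      by (simp add: l sum_distrib_left sum_distrib_right mult_ac)
    finally have "ua (t + int (i div m)) $ (i mod m) = a + \<sigma> * (l * \<psi> z)"
      using closed_loop_input_entry[OF loop \<eta> \<Theta> i]
      by (simp add: \<omega>_def gate_all_success a_def)
    moreover have "\<bar>ua (t + int (i div m)) $ (i mod m)\<bar> \<le> umax"
      using hard \<omega>_space loop i closed_loop_inputs_bounded_iff[OF loop dims, of umax]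
      unfolding hard_input_constraint_def by blast
    ultimately have "\<bar>a + \<sigma> * (l * \<psi> z)\<bar> \<le> umax" by simp
    \<comment> \<open>\<open>\<psi> z\<close> may be negative, so the left-hand side is bounded below via \<open>\<sigma> * u \<le> \<bar>u\<bar>\<close>.\<close>
    moreover have "\<bar>a\<bar> + l * \<psi> z \<le> \<bar>a + \<sigma> * (l * \<psi> z)\<bar>"
      by (cases "a < 0") (auto simp: \<sigma>_def)
    ultimately show ?thesis by linarith
  qed
  have "\<bar>a\<bar> + l * \<phi>max \<le> umax"
  proof (cases "l = 0")
    case True
    then show ?thesis using *[of 0] by simp
  next
    case False
    have "0 \<le> l" by (simp add: l sum_nonneg)
    with False have "0 < l" by simp
    then have "\<psi> z \<le> (umax - \<bar>a\<bar>) / l" for z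
      using *[of z] by (simp add: field_simps)
    then have "\<phi>max \<le> (umax - \<bar>a\<bar>) / l"
      unfolding tight[symmetric] by (intro cSUP_least) auto
    then show ?thesis
      using \<open>0 < l\<close> by (simp add: field_simps)
  qed
  then show ?thesis
    by (simp add: a_def l_def)
qed

theorem lemma6:
  fixes d m N Nr \<kappa> :: nat and t :: int
    and A B \<Theta> :: "real mat" and \<eta> :: "real vec" and ur :: "int \<Rightarrow> real vec"
    and up :: "realization \<Rightarrow> int \<Rightarrow> real vec"
    and \<psi> :: "real \<Rightarrow> real" and \<phi>max umax pc ps :: real
    and M :: "realization measure"
  assumes dims: "0 < d" "0 < m"
    and plant: "A \<in> carrier_mat d d" "B \<in> carrier_mat d m" "controllable d m A B"
    and model: "stochastic_model d pc ps M"
    and horizon: "0 < Nr" "Nr \<le> N" "0 \<le> t" "int Nr dvd t"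
    and reach: "reachability_index d m A B \<kappa>" "\<kappa> \<le> N"
    and past: "\<And>\<omega> k. \<omega> \<in> space M \<Longrightarrow> 0 \<le> k \<Longrightarrow> k < t \<Longrightarrow> up \<omega> k \<in> carrier_vec m"
    and reference: "\<And>k. ur k \<in> carrier_vec m"
    and params: "\<eta> \<in> carrier_vec (m * N)" "lower_block_triangular m d N \<Theta>"
    and sat: "saturation \<psi> \<phi>max"
  shows "let hard = hard_input_constraint d m N Nr \<kappa> A B \<psi> t up ur \<eta> \<Theta> M umax;
             bound = (\<forall>i<m * N.
               \<bar>stack m N t ur $ i + \<eta> $ i\<bar> + l1_norm (row \<Theta> i) * \<phi>max \<le> umax)
         in (bound \<longrightarrow> hard) \<and> ((SUP x. \<psi> x) = \<phi>max \<longrightarrow> (hard \<longleftrightarrow> bound))"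
proof -
  have space: "space M = realizations d"
    using model by (simp add: stochastic_model_def)
  have \<Theta>: "\<Theta> \<in> carrier_mat (m * N) (d * N)"
    using params(2) by (simp add: lower_block_triangular_def)
  note imp_hard = row_bound_imp_hard_input_constraint
    [OF dims(2) horizon(3) params(1) \<Theta> sat]
  note imp_bound = hard_input_constraint_imp_row_bound
    [where up = up, OF dims(2) horizon(3) plant(1,2) space past params(1) \<Theta> sat]
  show ?thesis
    unfolding Let_def
  proof (intro conjI impI iffI allI)
    fix i
    assume "(SUP x. \<psi> x) = \<phi>max" and "i < m * N"
      and "hard_input_constraint d m N Nr \<kappa> A B \<psi> t up ur \<eta> \<Theta> M umax"
    then show "\<bar>stack m N t ur $ i + \<eta> $ i\<bar> + l1_norm (row \<Theta> i) * \<phi>max \<le> umax"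
      by (intro imp_bound)
  qed (rule imp_hard, blast)+
qed

end
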